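(* For every integer $n \ge 3$, \[E_3(n) = \frac{n^n}{a_n(n)},\] where $E_3(n)$ is the expected number of rolls of a fair $n$-sided die until three consecutive (strictly) increasing values are seen, and $a_n(n)$ is the value at $x=n$ of the $n$-th polynomial of the sequence $(a_i(x))_{i\ge 1}$.
   Context: $E_3(n)$: let $X_1,X_2,\dots$ be i.i.d. uniform on $\{1,\dots,n\}$ and let $T$ be the least $t\ge 3$ with $X_{t-2}<X_{t-1}<X_t$; then $E_3(n)=\mathbb{E}[T]$. The polynomials $a_i(x)$ are defined by $a_1(x)=x-1$, $a_2(x)=x(x-2)$, and $a_{i+2}(x)=(2x-1)a_{i+1}(x)-(x^2-x+1)a_i(x)$ for $i\ge 1$. *)

theory Defs
  imports "HOL-Probability.Probability" "HOL-Computational_Algebra.Polynomial"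
begin

text \<open>The sequence starts at index 1. The value at 0 lies outside the range considered; it is
  set to the one polynomial for which the recurrence also holds at 0.\<close>

fun a_poly :: "nat \<Rightarrow> real poly" where
  "a_poly 0 = 1"
| "a_poly (Suc 0) = [:-1, 1:]"
| "a_poly (Suc (Suc 0)) = [:0, 1:] * [:-2, 1:]"
| "a_poly (Suc (Suc (Suc i))) =
     [:-1, 2:] * a_poly (Suc (Suc i)) - [:1, -1, 1:] * a_poly (Suc i)"

text \<open>The rolls are \<open>X 1, X 2, \<dots>\<close>. The infimum is the least element of the set if there is one
  and \<open>\<infinity>\<close> otherwise, so an outcome without three consecutive increasing rolls would
  contribute \<open>\<infinity>\<close> to an expectation.\<close>

definition increasing_time :: "(nat \<Rightarrow> 'w \<Rightarrow> nat) \<Rightarrow> 'w \<Rightarrow> enat" where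
  "increasing_time X \<omega> =
     (INF t \<in> {t. 3 \<le> t \<and> X (t - 2) \<omega> < X (t - 1) \<omega> \<and> X (t - 1) \<omega> < X t \<omega>}. enat t)"

definition expected_increasing_time :: "'w measure \<Rightarrow> (nat \<Rightarrow> 'w \<Rightarrow> nat) \<Rightarrow> ennreal" where
  "expected_increasing_time M X = (\<integral>\<^sup>+ \<omega>. ennreal_of_enat (increasing_time X \<omega>) \<partial>M)"

end

theory Submission
  imports Defs
begin

text \<open>
  Let \<open>A\<^sub>m\<close> be the number of words of length \<open>m\<close> over an \<open>n\<close>-letter ordered alphabet that contain
  no three consecutive increasing letters. The waiting time exceeds \<open>m\<close> exactly if the first
  \<open>m\<close> rolls form such a word, and the rolls are uniform on words, so the expectation is
  \<open>\<Sum>m. A\<^sub>m / n ^ m\<close>: the generating function of the \<open>A\<^sub>m\<close> at \<open>1 / n\<close>.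

  That generating function is the reciprocal of a polynomial. Cut a word of length \<open>N\<close> into a
  prefix without three consecutive increasing letters and a strictly increasing suffix of length
  \<open>j\<close>; there are \<open>A\<^bsub>N - j\<^esub> * (n choose j)\<close> words with such a cut. Weight the cut by \<open>chi j\<close>, where
  \<open>chi\<close> runs through \<open>1, -1, 0\<close> periodically. For a fixed nonempty word whose longest increasing
  suffix has length \<open>r\<close>, the admissible cuts are among those with \<open>j = r, r - 1, r - 2\<close>, because
  any longer prefix contains three letters of the final run. As soon as one of these cuts is
  admissible, all of them (with \<open>j \<ge> 0\<close>) are. Three consecutive values of \<open>chi\<close> sum to zero,
  and so do \<open>chi 1 + chi 0\<close>, so the weights cancel (\<open>signed_splits_eq_0\<close>). Summing over words,
  \<open>\<Sum>j\<le>N. chi j * (n choose j) * A\<^bsub>N - j\<^esub>\<close> vanishes for \<open>N > 0\<close> (\<open>good_words_recurrence\<close>).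
  Dividing by \<open>n ^ N\<close> and summing over \<open>N\<close> gives \<open>(\<Sum>j. chi j * (n choose j) / n ^ j) * (\<Sum>m. A\<^sub>m / n ^ m) = 1\<close>.

  Up to the factor \<open>n ^ n\<close>, the first sum is \<open>a\<^sub>n(n)\<close>: since \<open>chi\<close> is a combination of the powers
  of the two primitive cube roots of unity, \<open>\<Sum>j\<le>i. chi j * (i choose j) * x ^ (i - j)\<close> is a combination of
  the \<open>i\<close>-th powers of \<open>x\<close> plus these roots, which are the zeros of the characteristic
  polynomial \<open>t\<^sup>2 - (2 * x - 1) * t + (x\<^sup>2 - x + 1)\<close> of the recurrence for \<open>a\<^sub>i(x)\<close>
  (\<open>poly_a_poly_eq\<close>).
\<close>

section \<open>A closed form of the polynomials\<close>

text \<open>The coefficients of the power series \<open>1 / (1 + t + t\<^sup>2)\<close>.\<close>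
definition chi :: "nat \<Rightarrow> real" where
  "chi k = (if k mod 3 = 0 then 1 else if k mod 3 = 1 then - 1 else 0)"

lemma chi_three_consecutive: "chi k + chi (Suc k) + chi (Suc (Suc k)) = 0"
  unfolding chi_def by (simp add: mod_Suc) presburger

lemma chi_add_3: "chi (Suc (Suc (Suc k))) = chi k"
  using chi_three_consecutive[of k] chi_three_consecutive[of "Suc k"] by linarith

lemma chi_0 [simp]: "chi 0 = 1" and chi_2: "chi (Suc (Suc 0)) = 0"
  by (simp_all add: chi_def)

text \<open>With the binomial sums \<open>P c\<close> that use \<open>chi\<close> shifted by \<open>c\<close>, Pascal's rule expresses
  \<open>P c (i + 1)\<close> by \<open>P c i\<close> and \<open>P (c + 1) i\<close>, while \<open>P c + P (c + 1) + P (c + 2) = 0\<close>. Eliminating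
  \<open>P 1\<close> and \<open>P 2\<close> leaves the recurrence of the polynomials for \<open>P 0\<close>.\<close>
lemma poly_a_poly_eq:
  "poly (a_poly i) x = (\<Sum>j\<le>i. chi j * real (i choose j) * x ^ (i - j))"
proof -
  define P where "P c i = (\<Sum>j\<le>i. chi (c + j) * real (i choose j) * x ^ (i - j))" for c i
  have Pascal: "P c (Suc i) = x * P c i + P (Suc c) i" for c i
  proof -
    have "P c (Suc i) = chi c * x ^ Suc i
        + (\<Sum>j\<le>i. chi (c + Suc j) * real (Suc i choose Suc j) * x ^ (i - j))"
      unfolding P_def by (subst sum.atMost_Suc_shift) simp
    also have "(\<Sum>j\<le>i. chi (c + Suc j) * real (Suc i choose Suc j) * x ^ (i - j))
        = P (Suc c) i + (\<Sum>j\<le>i. chi (c + Suc j) * real (i choose Suc j) * x ^ (i - j))"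
      unfolding P_def by (simp add: sum.distrib algebra_simps)
    also have "chi c * x ^ Suc i + (P (Suc c) i
          + (\<Sum>j\<le>i. chi (c + Suc j) * real (i choose Suc j) * x ^ (i - j)))
        = P (Suc c) i + (\<Sum>j\<le>Suc i. chi (c + j) * real (i choose j) * x ^ (Suc i - j))"
      by (subst sum.atMost_Suc_shift) simp
    also have "(\<Sum>j\<le>Suc i. chi (c + j) * real (i choose j) * x ^ (Suc i - j)) = x * P c i"
      unfolding P_def by (simp add: sum_distrib_left Suc_diff_le algebra_simps)
    finally show ?thesis by simp
  qed
  have cancel: "P c i + P (Suc c) i + P (Suc (Suc c)) i = 0" for c i
  proof -
    have "P c i + P (Suc c) i + P (Suc (Suc c)) i =
        (\<Sum>j\<le>i. (chi (c + j) + chi (Suc (c + j)) + chi (Suc (Suc (c + j))))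
           * real (i choose j) * x ^ (i - j))"
      unfolding P_def by (simp add: sum.distrib algebra_simps)
    then show ?thesis by (simp add: chi_three_consecutive)
  qed
  have rec: "P 0 (Suc (Suc i)) = (2 * x - 1) * P 0 (Suc i) - (x\<^sup>2 - x + 1) * P 0 i" for i
    using Pascal[of 0 "Suc i"] Pascal[of 0 i] Pascal[of 1 i] cancel[of 0 i]
    by (simp add: power2_eq_square algebra_simps)
  have base: "P 0 0 = 1" "P 0 (Suc 0) = x - 1"
    by (simp_all add: P_def chi_def)
  have "poly (a_poly i) x = P 0 i"
  proof (induction i rule: a_poly.induct)
    case 3
    show ?case using rec[of 0] by (simp add: base power2_eq_square algebra_simps)
  next
    case (4 i)
    then show ?case
      using rec[of "Suc i"] by (simp add: power2_eq_square algebra_simps)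
  qed (simp_all add: base)
  then show ?thesis by (simp add: P_def)
qed

section \<open>Signed cuts of a word\<close>

text \<open>Words are read backwards, the most recent letter first, so that a further roll is a
  \<open>Cons\<close>. Three consecutive increasing rolls thus appear as two consecutive descents.\<close>
fun double_descent_free :: "'a::linorder list \<Rightarrow> bool" where
  "double_descent_free (x # y # z # w) \<longleftrightarrow>
     \<not> (y < x \<and> z < y) \<and> double_descent_free (y # z # w)"
| "double_descent_free w \<longleftrightarrow> True"

lemma double_descent_free_tail:
  "double_descent_free (x # w) \<Longrightarrow> double_descent_free w"
  by (cases "x # w" rule: double_descent_free.cases) auto

lemma double_descent_free_drop:
  "double_descent_free w \<Longrightarrow> double_descent_free (drop k w)"
proof (induction w arbitrary: k)
  case (Cons x w)
  then show ?case by (cases k) (auto dest: double_descent_free_tail)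
qed simp

lemma double_descent_free_ascent:
  "\<not> y < x \<Longrightarrow> double_descent_free (x # y # w) \<longleftrightarrow> double_descent_free (y # w)"
  by (cases w) auto

text \<open>The shift \<open>c\<close> is what allows recursion on the word: passing to the tail of a word turns a
  cut after \<open>j + 1\<close> letters into a cut after \<open>j\<close> letters.\<close>
definition signed_splits :: "nat \<Rightarrow> 'a::linorder list \<Rightarrow> real" where
  "signed_splits c w =
     (\<Sum>j\<le>length w. chi (c + j) *
        of_bool (double_descent_free (drop j w) \<and> sorted_wrt (>) (take j w)))"

lemma signed_splits_Cons:
  "signed_splits c (x # w) = chi c * of_bool (double_descent_free (x # w)) +
     (\<Sum>j\<le>length w. chi (Suc c + j) *
        of_bool (double_descent_free (drop j w) \<and> sorted_wrt (>) (x # take j w)))"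
  unfolding signed_splits_def by (simp add: sum.atMost_Suc_shift del: sum.atMost_Suc)

lemma signed_splits_descent:
  assumes "y < x"
  shows "signed_splits c (x # y # w) =
    chi c * of_bool (double_descent_free (x # y # w)) + signed_splits (Suc c) (y # w)"
proof -
  have "sorted_wrt (>) (x # take j (y # w)) \<longleftrightarrow> sorted_wrt (>) (take j (y # w))" for j
    using assms by (cases j) (auto intro: less_trans)
  then show ?thesis
    by (subst signed_splits_Cons) (simp add: signed_splits_def)
qed

text \<open>If the word does not start with a descent, only the cuts after zero and one letters are
  admissible, and they are admissible together. Their weights add up to minus the third one.\<close>
lemma signed_splits_ascent:
  assumes "\<not> y < x"
  shows "signed_splits c (x # y # w) =
    - chi (Suc (Suc c)) * of_bool (double_descent_free (x # y # w))"
proof -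
  have "signed_splits c (x # y # w) = chi c * of_bool (double_descent_free (x # y # w))
      + chi (Suc c) * of_bool (double_descent_free (y # w))"
    using assms by (subst signed_splits_Cons)
      (simp add: sum.atMost_Suc_shift del: sum.atMost_Suc)
  then show ?thesis
    using chi_three_consecutive[of c] assms
    by (simp add: double_descent_free_ascent algebra_simps)
qed

lemma signed_splits_singleton: "signed_splits c [x] = - chi (Suc (Suc c))"
  using chi_three_consecutive[of c] by (simp add: signed_splits_def)

text \<open>An initial descent means that the initial decreasing run has length at least two, so that
  the weights cancel in threes. When the run has length exactly two, the weights of the cuts
  after one and two letters are known from \<open>signed_splits_ascent\<close>, and the word is free of double
  descents exactly if its tail is. When it is longer, the word itself has a double descent and the
  sum is the one of its tail.\<close>
lemma signed_splits_long_run: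
  assumes "y < x"
  shows "signed_splits c (x # y # w) = 0"
  using assms
proof (induction w arbitrary: c x y)
  case Nil
  then show ?case
    by (simp add: signed_splits_descent signed_splits_singleton chi_add_3)
next
  case (Cons z w)
  show ?case
  proof (cases "z < y")
    case True
    with Cons show ?thesis by (simp add: signed_splits_descent[of y x])
  next
    case False
    with Cons.prems show ?thesis
      by (simp add: signed_splits_descent[of y x] signed_splits_ascent chi_add_3)
  qed
qed

text \<open>Without an initial descent the sum with shift \<open>c\<close> is a multiple of \<open>chi (c + 2)\<close>, and
  \<open>chi 2\<close> is zero.\<close>
lemma signed_splits_eq_0:
  assumes "w \<noteq> []"
  shows "signed_splits 0 w = 0"
proof -
  consider (one) x where "w = [x]"
    | (run) x y v where "w = x # y # v" "y < x"
    | (ascent) x y v where "w = x # y # v" "\<not> y < x"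
    using assms by (metis list.exhaust)
  then show ?thesis
    by cases (simp_all add: signed_splits_singleton signed_splits_long_run
        signed_splits_ascent chi_2)
qed

section \<open>Counting words without a double descent\<close>

definition words :: "'a set \<Rightarrow> nat \<Rightarrow> 'a list set" where
  "words A m = {w. set w \<subseteq> A \<and> length w = m}"

definition good_words :: "'a::linorder set \<Rightarrow> nat \<Rightarrow> 'a list set" where
  "good_words A m = {w \<in> words A m. double_descent_free w}"

lemma finite_words: "finite A \<Longrightarrow> finite (words A m)"
  unfolding words_def by (rule finite_lists_length_eq)

lemma card_words: "finite A \<Longrightarrow> card (words A m) = card A ^ m"
  unfolding words_def by (rule card_lists_length_eq)

lemma finite_good_words: "finite A \<Longrightarrow> finite (good_words A m)"
  by (simp add: good_words_def finite_words)

lemma card_decreasing_words: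
  fixes A :: "'a::linorder set"
  assumes "finite A"
  shows "card {v \<in> words A j. sorted_wrt (>) v} = card A choose j"
proof -
  have "bij_betw set {v \<in> words A j. sorted_wrt (>) v} {B. B \<subseteq> A \<and> card B = j}"
  proof (rule bij_betw_byWitness[where f' = "\<lambda>B. rev (sorted_list_of_set B)"])
    show "\<forall>v\<in>{v \<in> words A j. sorted_wrt (>) v}. rev (sorted_list_of_set (set v)) = v"
    proof clarify
      fix v :: "'a list" assume "sorted_wrt (>) v"
      then have "sorted_wrt (<) (rev v)" by (simp add: sorted_wrt_rev)
      then have "sorted_list_of_set (set (rev v)) = rev v"
        by (simp only: strict_sorted_iff sorted_list_of_set.idem_if_sorted_distinct)
      then show "rev (sorted_list_of_set (set v)) = v" by simp
    qed
    show "\<forall>B\<in>{B. B \<subseteq> A \<and> card B = j}. set (rev (sorted_list_of_set B)) = B"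
      using assms by (auto simp: finite_subset)
    show "set ` {v \<in> words A j. sorted_wrt (>) v} \<subseteq> {B. B \<subseteq> A \<and> card B = j}"
    proof clarify
      fix v :: "'a list" assume v: "v \<in> words A j" "sorted_wrt (>) v"
      then have "distinct (rev v)"
        unfolding strict_sorted_iff[symmetric] by (metis sorted_wrt_rev strict_sorted_iff)
      with v show "set v \<subseteq> A \<and> card (set v) = j"
        by (simp add: words_def distinct_card)
    qed
    show "(\<lambda>B. rev (sorted_list_of_set B)) ` {B. B \<subseteq> A \<and> card B = j}
        \<subseteq> {v \<in> words A j. sorted_wrt (>) v}"
      using assms by (auto simp: words_def sorted_wrt_rev finite_subset)
  qed
  then show ?thesis
    using assms by (simp add: bij_betw_same_card n_subsets)
qed

lemma card_splits:
  assumes "finite A" "j \<le> N"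
  shows "card {w \<in> words A N. double_descent_free (drop j w) \<and> sorted_wrt (>) (take j w)}
    = (card A choose j) * card (good_words A (N - j))" (is "card ?S = _")
proof -
  let ?D = "{v \<in> words A j. sorted_wrt (>) v}"
  have "bij_betw (\<lambda>(v, u). v @ u) (?D \<times> good_words A (N - j)) ?S"
    using assms(2)
    by (intro bij_betw_byWitness[where f' = "\<lambda>w. (take j w, drop j w)"])
       (auto simp: words_def good_words_def dest: in_set_takeD in_set_dropD)
  then have "card ?S = card (?D \<times> good_words A (N - j))"
    by (simp add: bij_betw_same_card)
  then show ?thesis
    using assms(1) by (simp add: card_cartesian_product card_decreasing_words)
qed

text \<open>Double counting: the sum over all words of the signed number of their cuts, where only the
  empty word contributes.\<close>
lemma good_words_recurrence:
  fixes A :: "'a::linorder set"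
  assumes "finite A"
  shows "(\<Sum>j\<le>N. chi j * real (card A choose j) * real (card (good_words A (N - j)))) = of_bool (N = 0)"
proof -
  have "(\<Sum>j\<le>N. chi j * real (card A choose j) * real (card (good_words A (N - j)))) =
      (\<Sum>j\<le>N. \<Sum>w\<in>words A N. chi j *
        of_bool (double_descent_free (drop j w) \<and> sorted_wrt (>) (take j w)))"
  proof (rule sum.cong[OF refl])
    fix j assume "j \<in> {..N}"
    then show "chi j * real (card A choose j) * real (card (good_words A (N - j))) =
        (\<Sum>w\<in>words A N. chi j *
          of_bool (double_descent_free (drop j w) \<and> sorted_wrt (>) (take j w)))"
      using card_splits[OF assms, of j N] finite_words[OF assms, of N]
      by (simp flip: sum_distrib_left add: Int_def)
  qed
  also have "\<dots> = (\<Sum>w\<in>words A N. signed_splits 0 w)"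
    by (subst sum.swap) (auto simp: signed_splits_def words_def intro!: sum.cong)
  also have "\<dots> = of_bool (N = 0)"
  proof (cases "N = 0")
    case True
    then show ?thesis by (simp add: words_def signed_splits_def cong: conj_cong)
  next
    case False
    then have "signed_splits 0 w = 0" if "w \<in> words A N" for w
      using that by (intro signed_splits_eq_0) (auto simp: words_def)
    with False show ?thesis by simp
  qed
  finally show ?thesis .
qed

text \<open>A good word of length \<open>m + 3\<close> is a good word of length \<open>m\<close> with three letters put in front,
  and these cannot be a fixed decreasing triple. This crude bound gives the geometric decay that
  makes the series converge.\<close>
lemma card_good_words_add_3:
  fixes A :: "'a::linorder set"
  assumes "finite A" "3 \<le> card A"
  shows "card (good_words A (m + 3)) \<le> (card A ^ 3 - 1) * card (good_words A m)"
proof -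
  let ?D = "{v \<in> words A 3. sorted_wrt (>) v}"
  have "card ?D = card A choose 3" using assms by (simp add: card_decreasing_words)
  then have "card ?D > 0" using assms by (simp)
  then obtain d where d: "d \<in> words A 3" "sorted_wrt (>) d"
    by (metis (no_types, lifting) card_gt_0_iff ex_in_conv mem_Collect_eq)
  have bad: "\<not> double_descent_free (d @ u)" for u
  proof -
    obtain x y z where "d = [x, y, z]"
      using d by (auto simp: words_def numeral_3_eq_3 length_Suc_conv)
    with d show ?thesis by auto
  qed
  have "good_words A (m + 3) \<subseteq> (\<lambda>(v, u). v @ u) ` ((words A 3 - {d}) \<times> good_words A m)"
  proof
    fix w assume w: "w \<in> good_words A (m + 3)"
    then have "take 3 w \<noteq> d"
      using bad by (metis (no_types, lifting) append_take_drop_id good_words_def mem_Collect_eq)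
    with w have "(take 3 w, drop 3 w) \<in> (words A 3 - {d}) \<times> good_words A m"
      by (auto simp: good_words_def words_def double_descent_free_drop
          dest: in_set_takeD in_set_dropD)
    moreover have "w = (case (take 3 w, drop 3 w) of (v, u) \<Rightarrow> v @ u)" by simp
    ultimately show "w \<in> (\<lambda>(v, u). v @ u) ` ((words A 3 - {d}) \<times> good_words A m)"
      by (rule rev_image_eqI)
  qed
  then have "card (good_words A (m + 3)) \<le> card ((words A 3 - {d}) \<times> good_words A m)"
    using assms by (intro surj_card_le) (auto simp: finite_words finite_good_words)
  then show ?thesis
    using assms d by (simp add: card_cartesian_product card_words finite_words)
qed


section \<open>Summing the frequencies of good words\<close>

text \<open>The frequencies shrink by a factor \<open>q < 1\<close> every three letters, so they are dominated by a
  geometric series whose ratio is the cube root of \<open>q\<close>.\<close>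
lemma good_word_frequency_summable:
  fixes A :: "'a::linorder set"
  assumes "finite A" "3 \<le> card A"
  shows "summable (\<lambda>m. real (card (good_words A m)) / real (card A) ^ m)"
proof -
  define n where "n = real (card A)"
  define p where "p m = real (card (good_words A m)) / n ^ m" for m
  define q where "q = 1 - 1 / n ^ 3"
  define r where "r = root 3 q"
  have n: "n \<ge> 3" using assms by (simp add: n_def)
  have "1 < n ^ 3" using n by simp
  then have q: "0 < q" "q < 1" using n by (simp_all add: q_def)
  then have r: "0 < r" "r < 1" "r ^ 3 = q"
    by (simp_all add: r_def odd_real_root_pow)
  have step: "p (m + 3) \<le> q * p m" for m
  proof -
    have "1 \<le> card A ^ 3" using assms by simp
    then have "real (card A ^ 3 - 1) = n ^ 3 - 1" by (simp add: n_def of_nat_diff)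
    then have "real (card (good_words A (m + 3))) \<le> (n ^ 3 - 1) * real (card (good_words A m))"
      using of_nat_mono[OF card_good_words_add_3[OF assms, of m], where 'a = real]
      by (simp only: of_nat_mult)
    then have "p (m + 3) \<le> (n ^ 3 - 1) * real (card (good_words A m)) / n ^ (m + 3)"
      unfolding p_def using n by (intro divide_right_mono) auto
    also have "\<dots> = q * p m"
      using n by (simp add: p_def q_def power_add field_simps)
    finally show ?thesis .
  qed
  have p_le_1: "p m \<le> 1" for m
  proof -
    have "card (good_words A m) \<le> card A ^ m"
      using card_mono[OF finite_words[OF assms(1)], of "good_words A m" m]
      by (auto simp: good_words_def card_words assms(1))
    then have "real (card (good_words A m)) \<le> n ^ m"
      using of_nat_mono[where 'a = real] by (fastforce simp: n_def)
    then show ?thesis using n by (simp add: p_def)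
  qed
  \<comment> \<open>The constant \<open>1 / r ^ 2\<close> makes the bound at least \<open>1\<close> for the three initial values.\<close>
  have bound: "p m \<le> r ^ m / r ^ 2" for m
  proof (induction m rule: less_induct)
    case (less m)
    show ?case
    proof (cases "m < 3")
      case True
      have "r ^ 2 \<le> r ^ m" using r True by (intro power_decreasing) auto
      then have "1 \<le> r ^ m / r ^ 2" using r by simp
      with p_le_1[of m] show ?thesis by linarith
    next
      case False
      then obtain k where k: "m = k + 3" by (metis add.commute le_Suc_ex not_less)
      have "p m \<le> q * p k" using step k by simp
      also have "\<dots> \<le> q * (r ^ k / r ^ 2)"
        using less.IH[of k] k q by (intro mult_left_mono) auto
      also have "\<dots> = r ^ m / r ^ 2" using r by (simp add: k power_add)
      finally show ?thesis .
    qed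
  qed
  have "summable (\<lambda>m. r ^ m / r ^ 2)"
    using r by (intro summable_divide summable_geometric) auto
  then have "summable p"
    by (rule summable_comparison_test'[of _ 0]) (use bound n in \<open>auto simp: p_def\<close>)
  then show ?thesis by (simp add: p_def[abs_def] n_def)
qed

text \<open>By the recurrence, the Cauchy product of the frequencies with the finite sequence \<open>c\<close>
  is the sequence \<open>1, 0, 0, \<dots>\<close>. Hence the two sums are reciprocal; in particular the polynomial
  does not vanish.\<close>
lemma good_word_frequency_sum:
  fixes A :: "'a::linorder set"
  assumes "finite A" "3 \<le> card A"
  defines "n \<equiv> card A"
  shows "(\<Sum>m. real (card (good_words A m)) / real n ^ m) = real n ^ n / poly (a_poly n) (real n)"
proof -
  define p where "p m = real (card (good_words A m)) / real n ^ m" for m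
  define c where "c j = chi j * real (n choose j) / real n ^ j" for j
  have n: "n > 0" using assms by simp
  have c_outside: "c j = 0" if "j \<notin> {..n}" for j using that by (simp add: c_def)
  have "summable (\<lambda>j. norm (c j))"
    by (rule summable_finite[of "{..n}"]) (use c_outside in auto)
  moreover have "summable (\<lambda>m. norm (p m))"
    using good_word_frequency_summable[OF assms(1,2)] by (simp add: p_def n_def)
  ultimately have "(\<lambda>N. \<Sum>j\<le>N. c j * p (N - j)) sums (suminf c * suminf p)"
    by (rule Cauchy_product_sums)
  moreover have "(\<Sum>j\<le>N. c j * p (N - j)) = of_bool (N = 0)" for N
  proof -
    have "(\<Sum>j\<le>N. c j * p (N - j)) =
        (\<Sum>j\<le>N. chi j * real (n choose j) * real (card (good_words A (N - j)))) / real n ^ N"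
      unfolding sum_divide_distrib
    proof (rule sum.cong[OF refl])
      fix j assume "j \<in> {..N}"
      then have "real n ^ N = real n ^ j * real n ^ (N - j)" by (simp flip: power_add)
      then show "c j * p (N - j) =
          chi j * real (n choose j) * real (card (good_words A (N - j))) / real n ^ N"
        by (simp add: c_def p_def)
    qed
    also have "\<dots> = of_bool (N = 0)"
      using good_words_recurrence[OF assms(1), of N] by (simp add: n_def)
    finally show ?thesis .
  qed
  moreover have "(\<lambda>N. of_bool (N = 0) :: real) sums 1"
    using sums_single[of 0 "\<lambda>_. 1 :: real"] by (simp add: of_bool_def)
  ultimately have "suminf c * suminf p = 1"
    by (simp add: sums_iff)
  moreover have "suminf c = poly (a_poly n) (real n) / real n ^ n"
  proof -
    have "suminf c = (\<Sum>j\<le>n. c j)"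
      by (rule suminf_finite) (use c_outside in auto)
    also have "\<dots> = (\<Sum>j\<le>n. chi j * real (n choose j) * real n ^ (n - j) / real n ^ n)"
    proof (rule sum.cong[OF refl])
      fix j assume "j \<in> {..n}"
      then have "real n ^ n = real n ^ j * real n ^ (n - j)" by (simp flip: power_add)
      then show "c j = chi j * real (n choose j) * real n ^ (n - j) / real n ^ n"
        using n by (simp add: c_def)
    qed
    finally show ?thesis by (simp add: poly_a_poly_eq sum_divide_distrib)
  qed
  ultimately have "poly (a_poly n) (real n) * suminf p = real n ^ n"
    using n by (simp add: field_simps)
  moreover from this have "poly (a_poly n) (real n) \<noteq> 0" using n by auto
  ultimately show ?thesis
    by (simp add: p_def[symmetric] field_simps)
qed

section \<open>The rolls as a random word\<close>

primrec history :: "(nat \<Rightarrow> 'w \<Rightarrow> 'a) \<Rightarrow> nat \<Rightarrow> 'w \<Rightarrow> 'a list" where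
  "history X 0 \<omega> = []"
| "history X (Suc m) \<omega> = X (Suc m) \<omega> # history X m \<omega>"

lemma history_eq_iff:
  "history X m \<omega> = w \<longleftrightarrow> length w = m \<and> (\<forall>i\<in>{1..m}. X i \<omega> = w ! (m - i))"
proof (induction m arbitrary: w)
  case (Suc m)
  show ?case
  proof (cases w)
    case (Cons x v)
    have "(\<forall>i\<in>{1..Suc m}. X i \<omega> = w ! (Suc m - i)) \<longleftrightarrow>
        X (Suc m) \<omega> = x \<and> (\<forall>i\<in>{1..m}. X i \<omega> = v ! (m - i))"
      by (auto simp: Cons atLeastAtMostSuc_conv Suc_diff_le)
    then show ?thesis using Suc[of v] by (auto simp: Cons)
  qed simp
qed auto

lemma double_descent_free_history_iff:
  "double_descent_free (history X m \<omega>) \<longleftrightarrow>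
     (\<forall>t\<in>{3..m}. \<not> (X (t - 2) \<omega> < X (t - 1) \<omega> \<and> X (t - 1) \<omega> < X t \<omega>))"
proof (induction m)
  case (Suc m)
  show ?case
  proof (cases "m < 2")
    case True
    then have "m = 0 \<or> m = 1" by auto
    then show ?thesis by auto
  next
    case False
    then obtain k where k: "m = Suc (Suc k)" by (metis add_2_eq_Suc le_Suc_ex not_less)
    have "{3..Suc m} = insert (Suc m) {3..m}" using False by auto
    then show ?thesis using Suc by (auto simp: k)
  qed
qed simp

lemma less_increasing_time_iff:
  "enat m < increasing_time X \<omega> \<longleftrightarrow> double_descent_free (history X m \<omega>)"
proof -
  have "enat m < increasing_time X \<omega> \<longleftrightarrow>
      (\<forall>t. 3 \<le> t \<and> X (t - 2) \<omega> < X (t - 1) \<omega> \<and> X (t - 1) \<omega> < X t \<omega> \<longrightarrow> m < t)"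
    unfolding increasing_time_def Suc_ile_eq[symmetric] le_INF_iff by (auto simp: Suc_le_eq)
  also have "\<dots> \<longleftrightarrow> double_descent_free (history X m \<omega>)"
    unfolding double_descent_free_history_iff by (meson atLeastAtMost_iff not_less)
  finally show ?thesis .
qed

lemma measurable_history:
  fixes X :: "nat \<Rightarrow> 'w \<Rightarrow> 'a::countable"
  assumes "\<And>i. i \<ge> 1 \<Longrightarrow> X i \<in> measurable M (count_space UNIV)"
  shows "history X m \<in> measurable M (count_space UNIV)"
proof (induction m)
  case (Suc m)
  have "(\<lambda>\<omega>. x # history X m \<omega>) \<in> measurable M (count_space UNIV)" for x
    by (rule measurable_compose[OF Suc]) simp
  then have "(\<lambda>\<omega>. X (Suc m) \<omega> # history X m \<omega>) \<in> measurable M (count_space UNIV)"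
    by (rule measurable_compose_countable) (simp add: assms)
  then show ?case by (simp cong: measurable_cong)
qed (simp cong: measurable_cong)

text \<open>A value in \<open>enat\<close> is determined by the natural numbers below it, so each event that the
  time takes a given value is a countable intersection of events about finitely many rolls and
  complements of such events.\<close>
lemma measurable_increasing_time:
  assumes "\<And>i. i \<ge> 1 \<Longrightarrow> X i \<in> measurable M (count_space UNIV)"
  shows "increasing_time X \<in> measurable M (count_space UNIV)"
proof -
  define F where "F m = {\<omega> \<in> space M. enat m < increasing_time X \<omega>}" for m
  have F: "F m \<in> sets M" for m
  proof -
    have "history X m -` {w. double_descent_free w} \<inter> space M \<in> sets M"
      by (rule measurable_sets[OF measurable_history[OF assms]]) simp_all
    then show ?thesis
      by (simp add: F_def less_increasing_time_iff vimage_def Int_def conj_commute)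
  qed
  have "increasing_time X -` {a} \<inter> space M \<in> sets M" for a
  proof -
    have eqI: "x = a" if "\<And>m. enat m < x \<longleftrightarrow> enat m < a" for x
    proof (rule linorder_cases[of x a])
      assume "x < a"
      then obtain k where "x = enat k" by (cases x) auto
      with that[of k] \<open>x < a\<close> show ?thesis by simp
    next
      assume "a < x"
      then obtain k where "a = enat k" by (cases a) auto
      with that[of k] \<open>a < x\<close> show ?thesis by simp
    qed
    have "increasing_time X -` {a} \<inter> space M = (\<Inter>m. if enat m < a then F m else space M - F m)"
    proof (intro equalityI subsetI)
      fix \<omega> assume "\<omega> \<in> increasing_time X -` {a} \<inter> space M"
      then show "\<omega> \<in> (\<Inter>m. if enat m < a then F m else space M - F m)"
        by (auto simp: F_def)
    next
      fix \<omega> assume "\<omega> \<in> (\<Inter>m. if enat m < a then F m else space M - F m)"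
      then have mem: "\<omega> \<in> (if enat m < a then F m else space M - F m)" for m
        by blast
      have "\<omega> \<in> space M \<and> (enat m < increasing_time X \<omega> \<longleftrightarrow> enat m < a)" for m
        using mem[of m] by (simp add: F_def split: if_splits)
      then show "\<omega> \<in> increasing_time X -` {a} \<inter> space M"
        using eqI[of "increasing_time X \<omega>"] by simp
    qed
    also have "\<dots> \<in> sets M" using F by (intro sets.countable_INT) auto
    finally show ?thesis .
  qed
  then show ?thesis
    by (auto simp: measurable_count_space_eq2_countable)
qed

lemma (in prob_space) prob_history_eq:
  assumes indep: "indep_vars (\<lambda>_. count_space UNIV) X {1..}"
    and unif: "\<And>i. i \<ge> 1 \<Longrightarrow> distr M (count_space UNIV) (X i) = measure_pmf (pmf_of_set A)"
    and A: "finite A" "A \<noteq> {}"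
    and w: "w \<in> words A m"
  shows "prob {\<omega> \<in> space M. history X m \<omega> = w} = 1 / real (card A) ^ m"
proof (cases "m = 0")
  case True
  with w show ?thesis by (simp add: words_def prob_space)
next
  case False
  have X: "X i \<in> measurable M (count_space UNIV)" if "i \<ge> 1" for i
    using indep that by (auto simp: indep_vars_def2)
  have "{\<omega> \<in> space M. history X m \<omega> = w} = (\<Inter>i\<in>{1..m}. X i -` {w ! (m - i)} \<inter> space M)"
    using w False unfolding history_eq_iff by (auto simp: words_def)
  also have "prob \<dots> = (\<Prod>i\<in>{1..m}. prob (X i -` {w ! (m - i)} \<inter> space M))"
    using False by (intro indep_varsD[OF indep]) auto
  also have "\<dots> = (\<Prod>i\<in>{1..m}. 1 / real (card A))"
  proof (rule prod.cong[OF refl])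
    fix i assume i: "i \<in> {1..m}"
    then have "w ! (m - i) \<in> A" using w by (auto simp: words_def subset_iff)
    then have "measure (distr M (count_space UNIV) (X i)) {w ! (m - i)} = 1 / real (card A)"
      using i A by (simp add: unif measure_pmf_single)
    then show "prob (X i -` {w ! (m - i)} \<inter> space M) = 1 / real (card A)"
      using i X by (simp add: measure_distr)
  qed
  finally show ?thesis by (simp add: power_one_over)
qed

text \<open>The words over \<open>A\<close> of length \<open>m\<close> have probabilities that already add up to \<open>1\<close>. Hence the
  event may be restricted to them, although the rolls may take values outside \<open>A\<close> on a null
  set.\<close>
lemma (in prob_space) prob_history_good:
  fixes X :: "nat \<Rightarrow> 'a \<Rightarrow> 'b::{linorder, countable}"
  assumes indep: "indep_vars (\<lambda>_. count_space UNIV) X {1..}"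
    and unif: "\<And>i. i \<ge> 1 \<Longrightarrow> distr M (count_space UNIV) (X i) = measure_pmf (pmf_of_set A)"
    and A: "finite A" "A \<noteq> {}"
  shows "prob {\<omega> \<in> space M. double_descent_free (history X m \<omega>)} =
    real (card (good_words A m)) / real (card A) ^ m"
proof -
  have X: "X i \<in> measurable M (count_space UNIV)" if "i \<ge> 1" for i
    using indep that by (auto simp: indep_vars_def2)
  note H [measurable] = measurable_history[OF X, where m = m]
  have in_finite: "prob {\<omega> \<in> space M. history X m \<omega> \<in> S} = real (card S) / real (card A) ^ m"
    if S: "S \<subseteq> words A m" for S
  proof -
    have fin: "finite S" using S finite_words[OF A(1)] finite_subset by blast
    have "prob (\<Union>w\<in>S. {\<omega> \<in> space M. history X m \<omega> = w})
        = (\<Sum>w\<in>S. prob {\<omega> \<in> space M. history X m \<omega> = w})"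
      using fin by (intro finite_measure_finite_Union) (auto simp: disjoint_family_on_def)
    also have "\<dots> = (\<Sum>w\<in>S. 1 / real (card A) ^ m)"
      using S by (intro sum.cong refl prob_history_eq[OF indep unif A]) auto
    also have "(\<Union>w\<in>S. {\<omega> \<in> space M. history X m \<omega> = w}) = {\<omega> \<in> space M. history X m \<omega> \<in> S}"
      by auto
    finally show ?thesis by simp
  qed
  have "prob {\<omega> \<in> space M. history X m \<omega> \<in> words A m} = 1"
    using A by (simp add: in_finite card_words)
  then have "AE \<omega> in M. history X m \<omega> \<in> words A m"
    by (subst (asm) prob_Collect_eq_1) auto
  then have "prob {\<omega> \<in> space M. double_descent_free (history X m \<omega>)}
      = prob {\<omega> \<in> space M. history X m \<omega> \<in> good_words A m}"
    by (intro finite_measure_eq_AE) (auto simp: good_words_def)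
  also have "\<dots> = real (card (good_words A m)) / real (card A) ^ m"
    by (rule in_finite) (auto simp: good_words_def)
  finally show ?thesis .
qed

section \<open>The expected waiting time\<close>

theorem theorem2p12:
  fixes M :: "'w measure" and X :: "nat \<Rightarrow> 'w \<Rightarrow> nat" and n :: nat
  assumes "n \<ge> 3"
    and "prob_space M"
    and "prob_space.indep_vars M (\<lambda>_. count_space UNIV) X {1..}"
    and "\<And>i. i \<ge> 1 \<Longrightarrow> distr M (count_space UNIV) (X i) = measure_pmf (pmf_of_set {1..n})"
  shows "expected_increasing_time M X = ennreal (real n ^ n / poly (a_poly n) (real n))"
proof -
  interpret prob_space M by fact
  have X: "X i \<in> measurable M (count_space UNIV)" if "i \<ge> 1" for i
    using assms(3) that by (auto simp: indep_vars_def2)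
  let ?p = "\<lambda>m. real (card (good_words {1..n} m)) / real n ^ m"
  have "expected_increasing_time M X =
      (\<Sum>m. emeasure M {\<omega> \<in> space M. enat m < increasing_time X \<omega>})"
    unfolding expected_increasing_time_def
    by (rule nn_integral_enat_function[OF measurable_increasing_time[OF X]])
  also have "\<dots> = (\<Sum>m. ennreal (?p m))"
  proof (rule arg_cong[where f = suminf], rule ext)
    fix m
    show "emeasure M {\<omega> \<in> space M. enat m < increasing_time X \<omega>} = ennreal (?p m)"
      using prob_history_good[OF assms(3,4), of m] assms(1)
      by (simp add: emeasure_eq_measure less_increasing_time_iff)
  qed
  also have "\<dots> = ennreal (\<Sum>m. ?p m)"
    using good_word_frequency_summable[of "{1..n}"] assms(1)
    by (intro suminf_ennreal2) auto
  also have "(\<Sum>m. ?p m) = real n ^ n / poly (a_poly n) (real n)"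
    using good_word_frequency_sum[of "{1..n}"] assms(1) by simp
  finally show ?thesis .
qed

end
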